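(* Let $\mathcal{X}$ be a finite set with $|\mathcal{X}|\ge 2$ and let $(\mathcal{X},\mathcal{E})$, $\mathcal{E}\subset\mathcal{X}^2$, be a strongly connected directed graph. Put $\mathcal{E}^\star=\{(x,x'):(x',x)\in\mathcal{E}\}$. (Time reversal of m-family) If $\mathcal{V}_m$ is an m-family over $(\mathcal{X},\mathcal{E})$, then $\mathcal{V}_m^\star=\{P^\star: P\in\mathcal{V}_m\}$ is an m-family over $(\mathcal{X},\mathcal{E}^\star)$. Furthermore, if $\mathcal{V}_m$ is the m-family generated by affinely independent $Q_0,Q_1,\dots,Q_d\in\mathcal{Q}(\mathcal{X},\mathcal{E})$ with parameter set $\Xi$, then $$\mathcal{V}_m^\star=\Big\{P_\xi\in\mathcal{W}(\mathcal{X},\mathcal{E}^\star): Q_\xi=\sum_{i=1}^d\xi^iQ_i^\star+\Big(1-\sum_{i=1}^d\xi^i\Big)Q_0^\star,\ \xi\in\Xi^\star\Big\},$$ where $Q_\xi$ is the edge measure of $P_\xi$, $Q_i^\star=Q_i^{\intercal}$, and $\Xi^\star=\{\xi\in\mathbb{R}^d: Q_\xi(x,x')>0\ \forall (x,x')\in\mathcal{E}^\star\}=\Xi$. (Time reversal of e-family) If $\mathcal{V}_e$ is an e-family over $(\mathcal{X},\mathcal{E})$, then $\mathcal{V}_e^\star=\{P^\star:P\in\mathcal{V}_e\}$ is an e-family over $(\mathcal{X},\mathcal{E}^\star)$. Furthermore, if $\mathcal{V}_e=\{P_\theta:\theta\in\Theta\}$ is generated by $K$ and $g_1,\dots,g_d$,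 with potential $\psi_\theta=\psi(\theta)$, then $\mathcal{V}_e^\star=\{P_\theta^\star:\theta\in\Theta\}$ with $$\log P^\star_\theta(x,x')=K(x',x)+\sum_{i=1}^d\theta^ig_i(x',x)+L_\theta(x')-L_\theta(x)-\psi_\theta$$ when $(x,x')\in\mathcal{E}^\star$, and $P^\star_\theta(x,x')=0$ otherwise, where $\exp[L_\theta]$ (entrywise exponential of $L_\theta\in\mathbb{R}^{\mathcal{X}}$) is the left Perron–Frobenius eigenvector of the non-negative irreducible matrix $\widetilde P_\theta$ defined by $\widetilde P_\theta(x,x')=\exp\big(K(x,x')+\sum_{i=1}^d\theta^ig_i(x,x')\big)$ for $(x,x')\in\mathcal{E}$ and $0$ otherwise (equivalently, the right Perron–Frobenius eigenvector of $\widetilde P_\theta^\star=\widetilde P_\theta^{\intercal}$).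
   Context: $\mathcal{W}(\mathcal{X},\mathcal{E})$: row-stochastic matrices $P$ on $\mathcal{X}$ with $P(x,x')>0$ exactly for $(x,x')\in\mathcal{E}$. Such $P$ has a unique stationary distribution $\pi>0$; its edge measure is $Q(x,x')=\pi(x)P(x,x')$, and $\mathcal{Q}(\mathcal{X},\mathcal{E})$ is the set of all such edge measures. The time-reversal of $P$ is $P^\star(x,x')=\pi(x')P(x',x)/\pi(x)$; its edge measure is $Q^\star=Q^{\intercal}$. m-family over $(\mathcal{X},\mathcal{E})$ of dimension $d$, generated by affinely independent $Q_0,\dots,Q_d\in\mathcal{Q}(\mathcal{X},\mathcal{E})$: the set $\{P_\xi\in\mathcal{W}(\mathcal{X},\mathcal{E}): Q_\xi=\sum_{i=1}^d\xi^iQ_i+(1-\sum_{i=1}^d\xi^i)Q_0,\ \xi\in\Xi\}$, where $Q_\xi$ is the edge measure of $P_\xi$ and $\Xi=\{\xi\in\mathbb{R}^d:Q_\xi(x,x')>0\ \forall(x,x')\in\mathcal{E}\}$. e-family over $(\mathcal{X},\mathcal{E})$ of dimension $d$, generated by the carrier kernel $K:\mathcal{X}^2\to\mathbb{R}$ and generators $g_1,\dots,g_d:\mathcal{X}^2\to\mathbb{R}$: a family $\{P_\theta:\theta\in\Theta\}\subset\mathcal{W}(\mathcal{X},\mathcal{E})$, with $\Theta\subset\mathbb{R}^d$ connected and containing an open ball centered at $0$, for which there are $R:\Theta\times\mathcal{X}\to\mathbb{R}$ and $\psi:\Theta\to\mathbb{R}$ with $\log P_\theta(x,x')=K(x,x')+\sum_{i=1}^d\theta^ig_i(x,x')+R(\theta,x')-R(\theta,x)-\psi(\theta)$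 for $(x,x')\in\mathcal{E}$ and $P_\theta(x,x')=0$ otherwise. It is assumed that $g_1,\dots,g_d$ are linearly independent modulo functions on $\mathcal{E}$ of the form $(x,x')\mapsto f(x')-f(x)+c$ with $f\in\mathbb{R}^{\mathcal{X}}$, $c\in\mathbb{R}$. *)

theory Defs
  imports "HOL-Analysis.Analysis"
begin

text \<open>
  The state space is the universe of a finite type \<open>'x\<close>, the graph is its edge set
  \<open>E :: ('x \<times> 'x) set\<close>, and functions on \<open>'x \<times> 'x\<close> are matrices \<open>real ^ 'x ^ 'x\<close>, with
  \<open>A $ x $ x'\<close> standing for \<open>A(x, x')\<close>.  The reversed graph is \<open>E\<inverse>\<close>.
\<close>

definition strongly_connected :: "('x \<times> 'x) set \<Rightarrow> bool" where
  "strongly_connected E \<longleftrightarrow> (\<forall>x y. (x, y) \<in> E\<^sup>*)"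

definition kernels :: "('x::finite \<times> 'x) set \<Rightarrow> (real ^ 'x ^ 'x) set" where
  "kernels E = {P. (\<forall>x. (\<Sum>x'\<in>UNIV. P $ x $ x') = 1) \<and>
                   (\<forall>x x'. (x, x') \<in> E \<longrightarrow> P $ x $ x' > 0) \<and>
                   (\<forall>x x'. (x, x') \<notin> E \<longrightarrow> P $ x $ x' = 0)}"

definition is_stationary :: "real ^ 'x ^ 'x \<Rightarrow> real ^ 'x::finite \<Rightarrow> bool" where
  "is_stationary P \<pi> \<longleftrightarrow> (\<forall>x. \<pi> $ x \<ge> 0) \<and> (\<Sum>x\<in>UNIV. \<pi> $ x) = 1 \<and> \<pi> v* P = \<pi>"

text \<open>Well defined for kernels over a strongly connected graph.\<close>

definition stationary :: "real ^ 'x ^ 'x \<Rightarrow> real ^ 'x::finite" where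
  "stationary P = (THE \<pi>. is_stationary P \<pi>)"

definition edge_measure :: "real ^ 'x ^ 'x \<Rightarrow> real ^ 'x ^ 'x::finite" where
  "edge_measure P = (\<chi> x x'. stationary P $ x * P $ x $ x')"

definition edge_measures :: "('x::finite \<times> 'x) set \<Rightarrow> (real ^ 'x ^ 'x) set" where
  "edge_measures E = edge_measure ` kernels E"

definition reversal :: "real ^ 'x ^ 'x \<Rightarrow> real ^ 'x ^ 'x::finite" where
  "reversal P = (\<chi> x x'. stationary P $ x' * P $ x' $ x / stationary P $ x)"


subsection \<open>m-families\<close>

text \<open>
  The dimension \<open>d\<close> is any natural number, and \<open>\<real>\<^sup>d\<close> is the library's topology
  \<^term>\<open>Euclidean_space d\<close> on sequences vanishing from index \<open>d\<close> on.  Coordinates are thus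
  counted from 0: the \<open>i\<close>-th coordinate of the mathematical notation, \<open>1 \<le> i \<le> d\<close>,
  is \<open>\<xi> (i - 1)\<close>, and it goes with \<open>Q i\<close>.
\<close>

definition m_comb :: "nat \<Rightarrow> (nat \<Rightarrow> real ^ 'x ^ 'x) \<Rightarrow> (nat \<Rightarrow> real) \<Rightarrow> real ^ 'x ^ 'x::finite" where
  "m_comb d Q \<xi> = (\<Sum>i<d. \<xi> i *\<^sub>R Q (Suc i)) + (1 - (\<Sum>i<d. \<xi> i)) *\<^sub>R Q 0"

definition m_params :: "('x::finite \<times> 'x) set \<Rightarrow> nat \<Rightarrow> (nat \<Rightarrow> real ^ 'x ^ 'x) \<Rightarrow> (nat \<Rightarrow> real) set" where
  "m_params E d Q = {\<xi> \<in> topspace (Euclidean_space d). \<forall>(x, x') \<in> E. m_comb d Q \<xi> $ x $ x' > 0}"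

definition m_generators :: "('x::finite \<times> 'x) set \<Rightarrow> nat \<Rightarrow> (nat \<Rightarrow> real ^ 'x ^ 'x) \<Rightarrow> bool" where
  "m_generators E d Q \<longleftrightarrow>
     Q ` {..d} \<subseteq> edge_measures E \<and> inj_on Q {..d} \<and> \<not> affine_dependent (Q ` {..d})"

definition m_family :: "('x::finite \<times> 'x) set \<Rightarrow> nat \<Rightarrow> (nat \<Rightarrow> real ^ 'x ^ 'x) \<Rightarrow> (real ^ 'x ^ 'x) set" where
  "m_family E d Q = {P \<in> kernels E. \<exists>\<xi> \<in> m_params E d Q. edge_measure P = m_comb d Q \<xi>}"

definition is_m_family :: "('x::finite \<times> 'x) set \<Rightarrow> (real ^ 'x ^ 'x) set \<Rightarrow> bool" where
  "is_m_family E V \<longleftrightarrow> (\<exists>d Q. m_generators E d Q \<and> V = m_family E d Q)"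


subsection \<open>e-families\<close>

text \<open>Here \<open>g i\<close>, for \<open>i < d\<close>, is the generator that goes with the coordinate \<open>\<theta> i\<close>.\<close>

definition e_exponent ::
  "nat \<Rightarrow> real ^ 'x ^ 'x \<Rightarrow> (nat \<Rightarrow> real ^ 'x ^ 'x) \<Rightarrow> (nat \<Rightarrow> real) \<Rightarrow> 'x::finite \<Rightarrow> 'x \<Rightarrow> real" where
  "e_exponent d K g \<theta> x x' = K $ x $ x' + (\<Sum>i<d. \<theta> i * g i $ x $ x')"

definition e_params :: "nat \<Rightarrow> (nat \<Rightarrow> real) set \<Rightarrow> bool" where
  "e_params d \<Theta> \<longleftrightarrow>
     connectedin (Euclidean_space d) \<Theta> \<and>
     (\<exists>r>0. {\<theta> \<in> topspace (Euclidean_space d). sqrt (\<Sum>i<d. (\<theta> i)\<^sup>2) < r} \<subseteq> \<Theta>)"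

definition e_generators :: "('x::finite \<times> 'x) set \<Rightarrow> nat \<Rightarrow> (nat \<Rightarrow> real ^ 'x ^ 'x) \<Rightarrow> bool" where
  "e_generators E d g \<longleftrightarrow>
     (\<forall>a :: nat \<Rightarrow> real. \<forall>f :: 'x \<Rightarrow> real. \<forall>c :: real.
        (\<forall>(x, x') \<in> E. (\<Sum>i<d. a i * g i $ x $ x') = f x' - f x + c) \<longrightarrow> (\<forall>i<d. a i = 0))"

definition e_family ::
  "('x::finite \<times> 'x) set \<Rightarrow> nat \<Rightarrow> real ^ 'x ^ 'x \<Rightarrow> (nat \<Rightarrow> real ^ 'x ^ 'x) \<Rightarrow>
   (nat \<Rightarrow> real) set \<Rightarrow> ((nat \<Rightarrow> real) \<Rightarrow> real) \<Rightarrow> ((nat \<Rightarrow> real) \<Rightarrow> real ^ 'x ^ 'x) \<Rightarrow> bool" where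
  "e_family E d K g \<Theta> \<psi> P \<longleftrightarrow>
     e_params d \<Theta> \<and> e_generators E d g \<and> P ` \<Theta> \<subseteq> kernels E \<and>
     (\<exists>R :: (nat \<Rightarrow> real) \<Rightarrow> 'x \<Rightarrow> real. \<forall>\<theta>\<in>\<Theta>. \<forall>x x'.
        ((x, x') \<in> E \<longrightarrow> ln (P \<theta> $ x $ x') = e_exponent d K g \<theta> x x' + R \<theta> x' - R \<theta> x - \<psi> \<theta>) \<and>
        ((x, x') \<notin> E \<longrightarrow> P \<theta> $ x $ x' = 0))"

definition is_e_family :: "('x::finite \<times> 'x) set \<Rightarrow> (real ^ 'x ^ 'x) set \<Rightarrow> bool" where
  "is_e_family E V \<longleftrightarrow> (\<exists>d K g \<Theta> \<psi> P. e_family E d K g \<Theta> \<psi> P \<and> V = P ` \<Theta>)"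

definition e_tilde ::
  "('x::finite \<times> 'x) set \<Rightarrow> nat \<Rightarrow> real ^ 'x ^ 'x \<Rightarrow> (nat \<Rightarrow> real ^ 'x ^ 'x) \<Rightarrow> (nat \<Rightarrow> real) \<Rightarrow> real ^ 'x ^ 'x" where
  "e_tilde E d K g \<theta> = (\<chi> x x'. if (x, x') \<in> E then exp (e_exponent d K g \<theta> x x') else 0)"


subsection \<open>Perron--Frobenius eigenvectors\<close>

definition spec_radius :: "real ^ 'x ^ 'x::finite \<Rightarrow> real" where
  "spec_radius A =
     Sup {cmod l |l. \<exists>w :: complex ^ 'x. w \<noteq> 0 \<and> map_matrix complex_of_real A *v w = l *s w}"

text \<open>
  Perron--Frobenius eigenvectors of a non-negative irreducible matrix: the entrywise positive
  eigenvectors for its spectral radius.  They are determined up to a positive factor only.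
\<close>

definition left_PF_eigenvector :: "real ^ 'x ^ 'x \<Rightarrow> real ^ 'x::finite \<Rightarrow> bool" where
  "left_PF_eigenvector A v \<longleftrightarrow> (\<forall>x. v $ x > 0) \<and> v v* A = spec_radius A *s v"

definition right_PF_eigenvector :: "real ^ 'x ^ 'x \<Rightarrow> real ^ 'x::finite \<Rightarrow> bool" where
  "right_PF_eigenvector A v \<longleftrightarrow> (\<forall>x. v $ x > 0) \<and> A *v v = spec_radius A *s v"

definition exp_vec :: "real ^ 'x \<Rightarrow> real ^ 'x::finite" where
  "exp_vec L = (\<chi> x. exp (L $ x))"

end

theory Submission
  imports Defs
begin

text \<open>
  Reversal preserves the stationary distribution, transposes the edge measure and is an
  involution.  The combinations that define an m-family commute with transposition, so an
  m-family is reversed by transposing its generators.  For an e-family, taking the logarithm of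
  \<open>\<pi>(x') P(x', x) / \<pi>(x)\<close> transposes the carrier and the generators and replaces \<open>R\<close> by
  \<open>ln \<pi> - R\<close>.  Finally the matrix of exponents is \<open>exp \<psi>\<close> times the conjugate of the kernel by
  \<open>diag (exp R)\<close>; its spectral radius is therefore \<open>exp \<psi>\<close>, and its positive left eigenvectors
  are the multiples of \<open>\<pi> exp (- R)\<close>.
\<close>

subsection \<open>Stationary distributions\<close>

lemma strongly_connected_converse: "strongly_connected E \<Longrightarrow> strongly_connected (E\<inverse>)"
  by (simp add: strongly_connected_def rtrancl_converse)

lemma vector_matrix_mult_nth:
  fixes v :: "real ^ 'm" and A :: "real ^ 'n ^ 'm"
  shows "(v v* A) $ j = (\<Sum>i\<in>UNIV. v $ i * A $ i $ j)"
  by (simp add: vector_matrix_mult_def)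

lemma transpose_nth: "transpose A $ i $ j = A $ j $ i"
  by (simp add: transpose_def)

lemma kernels_nonneg: "P \<in> kernels E \<Longrightarrow> 0 \<le> P $ x $ y"
  by (cases "(x, y) \<in> E") (auto simp: kernels_def less_imp_le)

lemma kernels_sum: "P \<in> kernels E \<Longrightarrow> (\<Sum>y\<in>UNIV. P $ x $ y) = 1"
  by (simp add: kernels_def)

lemma kernels_pos: "P \<in> kernels E \<Longrightarrow> (x, y) \<in> E \<Longrightarrow> 0 < P $ x $ y"
  by (simp add: kernels_def)

lemma kernels_zero: "P \<in> kernels E \<Longrightarrow> (x, y) \<notin> E \<Longrightarrow> P $ x $ y = 0"
  by (simp add: kernels_def)

text \<open>Zeros spread backwards along edges: \<open>w $ y\<close> is a sum of non-negative terms,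
  so \<open>w $ y = 0\<close> forces \<open>w $ x = 0\<close> whenever \<open>(x, y)\<close> is an
  edge. Every vertex has a path to \<open>z\<close>.\<close>

lemma nonneg_invariant_zero:
  assumes E: "strongly_connected E" and P: "P \<in> kernels E"
    and nonneg: "\<And>x. 0 \<le> w $ x" and inv: "w v* P = w" and z: "w $ z = 0"
  shows "w = 0"
proof -
  have "w $ x = 0" for x
  proof -
    have "(x, z) \<in> E\<^sup>*" using E by (simp add: strongly_connected_def)
    then show ?thesis
    proof (induction rule: converse_rtrancl_induct)
      case base show ?case by (rule z)
    next
      case (step x y)
      have "(\<Sum>u\<in>UNIV. w $ u * P $ u $ y) = 0"
        using step.IH inv by (metis vector_matrix_mult_nth)
      then have "w $ x * P $ x $ y = 0"
        by (subst (asm) sum_nonneg_eq_0_iff) (auto simp: nonneg kernels_nonneg[OF P])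
      with kernels_pos[OF P step.hyps(1)] show ?case by simp
    qed
  qed
  then show ?thesis by (simp add: vec_eq_iff)
qed

lemma ex_nonzero_invariant:
  assumes P: "P \<in> kernels E"
  shows "\<exists>w. w \<noteq> 0 \<and> w v* P = w"
proof (rule ccontr)
  assume none: "\<nexists>w. w \<noteq> 0 \<and> w v* P = w"
  let ?M = "P - mat 1"
  have "\<forall>w. transpose ?M *v w = 0 \<longrightarrow> w = 0"
    using none by (auto simp: vector_matrix_mult_diff_rdistrib)
  then obtain B where "B ** transpose ?M = mat 1"
    using matrix_left_invertible_ker by blast
  then have "?M ** transpose B = mat 1"
    by (metis matrix_transpose_mul transpose_mat transpose_transpose)
  \<comment> \<open>One-sided inverses of square matrices are two-sided; this passes from the
    trivial left kernel of \<open>?M\<close> to a trivial right kernel, which the constant vector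
    contradicts.\<close>
  then have "transpose B ** ?M = mat 1"
    by (simp add: matrix_left_right_inverse)
  then have "\<forall>x. ?M *v x = 0 \<longrightarrow> x = 0"
    using matrix_left_invertible_ker by blast
  moreover have "P *v 1 = 1"
    by (simp add: vec_eq_iff matrix_vector_mult_def kernels_sum[OF P])
  then have "?M *v 1 = 0" by (simp add: matrix_vector_mult_diff_rdistrib)
  ultimately show False by (metis zero_neq_one)
qed

text \<open>The triangle inequality gives \<open>\<bar>w\<bar> \<le> \<bar>w\<bar> P\<close> entrywise, and both sides have the same
  total because \<open>P\<close> is row-stochastic.\<close>

lemma abs_invariant:
  assumes P: "P \<in> kernels E" and inv: "w v* P = w"
  shows "(\<chi> x. \<bar>w $ x\<bar>) v* P = (\<chi> x. \<bar>w $ x\<bar>)"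
proof -
  let ?d = "\<lambda>y. (\<Sum>x\<in>UNIV. \<bar>w $ x\<bar> * P $ x $ y) - \<bar>w $ y\<bar>"
  have "\<bar>w $ y\<bar> \<le> (\<Sum>x\<in>UNIV. \<bar>w $ x\<bar> * P $ x $ y)" for y
  proof -
    have "\<bar>w $ y\<bar> = \<bar>\<Sum>x\<in>UNIV. w $ x * P $ x $ y\<bar>"
      using inv by (metis vector_matrix_mult_nth)
    also have "\<dots> \<le> (\<Sum>x\<in>UNIV. \<bar>w $ x * P $ x $ y\<bar>)" by (rule sum_abs)
    finally show ?thesis by (simp add: abs_mult kernels_nonneg[OF P])
  qed
  then have nonneg: "0 \<le> ?d y" for y by simp
  have "(\<Sum>y\<in>UNIV. \<Sum>x\<in>UNIV. \<bar>w $ x\<bar> * P $ x $ y) = (\<Sum>x\<in>UNIV. \<bar>w $ x\<bar>)"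
    by (subst sum.swap) (simp add: sum_distrib_left[symmetric] kernels_sum[OF P])
  then have "(\<Sum>y\<in>UNIV. ?d y) = 0" by (simp add: sum_subtractf)
  then have "?d y = 0" for y
    using sum_nonneg_eq_0_iff[of UNIV ?d] nonneg by simp
  then show ?thesis by (simp add: vec_eq_iff vector_matrix_mult_nth)
qed

lemma ex_is_stationary:
  assumes P: "P \<in> kernels E"
  shows "\<exists>\<pi>. is_stationary P \<pi>"
proof -
  obtain w where "w \<noteq> 0" and inv: "w v* P = w"
    using ex_nonzero_invariant[OF P] by blast
  let ?s = "\<Sum>x\<in>UNIV. \<bar>w $ x\<bar>"
  have "?s \<noteq> 0"
    using \<open>w \<noteq> 0\<close> by (auto simp: vec_eq_iff sum_nonneg_eq_0_iff)
  moreover have "?s \<ge> 0" by (simp add: sum_nonneg)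
  ultimately have "?s > 0" by linarith
  let ?\<pi> = "(1 / ?s) *\<^sub>R (\<chi> x. \<bar>w $ x\<bar>)"
  have "?\<pi> v* P = ?\<pi>"
    using abs_invariant[OF P inv] by (simp add: scaleR_vector_matrix_assoc)
  moreover have "(\<Sum>x\<in>UNIV. ?\<pi> $ x) = 1"
    using \<open>?s > 0\<close> by (simp add: sum_divide_distrib[symmetric])
  ultimately have "is_stationary P ?\<pi>"
    using \<open>?s > 0\<close> by (simp add: is_stationary_def)
  then show ?thesis by blast
qed

lemma is_stationary_pos:
  assumes "strongly_connected E" "P \<in> kernels E" "is_stationary P \<pi>"
  shows "0 < \<pi> $ x"
proof (rule ccontr)
  assume "\<not> 0 < \<pi> $ x"
  with assms(3) have "\<pi> $ x = 0" by (metis is_stationary_def order_le_less)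
  then have "\<pi> = 0"
    using assms nonneg_invariant_zero by (metis is_stationary_def)
  with assms(3) show False by (simp add: is_stationary_def)
qed

text \<open>Subtracting from one invariant vector the largest multiple of another that keeps it
  non-negative produces a zero entry.\<close>

lemma invariant_unique:
  assumes E: "strongly_connected E" and P: "P \<in> kernels E"
    and pos: "\<And>x. 0 < u $ x" and u: "u v* P = u" and w: "w v* P = w"
  shows "\<exists>c. w = c *\<^sub>R u"
proof -
  define c where "c = Min (range (\<lambda>x. w $ x / u $ x))"
  let ?d = "w - c *\<^sub>R u"
  have "c \<in> range (\<lambda>x. w $ x / u $ x)" unfolding c_def by (intro Min_in) auto
  then obtain z where "c = w $ z / u $ z" by blast
  then have "?d $ z = 0" using pos[of z] by simp
  moreover have "0 \<le> ?d $ x" for x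
  proof -
    have "c \<le> w $ x / u $ x" unfolding c_def by (intro Min_le) auto
    then show ?thesis using pos[of x] by (simp add: pos_le_divide_eq)
  qed
  moreover have "?d v* P = ?d"
    using u w by (simp add: vector_matrix_mult_diff_distrib scaleR_vector_matrix_assoc)
  ultimately have "?d = 0"
    using nonneg_invariant_zero[OF E P] by blast
  then show ?thesis by auto
qed

lemma is_stationary_unique:
  assumes E: "strongly_connected E" and P: "P \<in> kernels E"
    and "is_stationary P \<pi>" "is_stationary P \<rho>"
  shows "\<rho> = \<pi>"
proof -
  obtain c where c: "\<rho> = c *\<^sub>R \<pi>"
    using invariant_unique[OF E P is_stationary_pos[OF E P assms(3)]] assms(3,4)
    by (metis is_stationary_def)
  have "(\<Sum>x\<in>UNIV. \<rho> $ x) = c * (\<Sum>x\<in>UNIV. \<pi> $ x)"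
    by (simp add: c sum_distrib_left)
  then have "c = 1" using assms(3,4) by (simp add: is_stationary_def)
  with c show ?thesis by simp
qed

text \<open>Since \<open>stationary\<close> is a definite description, later arguments identify it
  by exhibiting one stationary vector.\<close>

lemma stationary_eqI:
  assumes "strongly_connected E" "P \<in> kernels E" "is_stationary P \<pi>"
  shows "stationary P = \<pi>"
  unfolding stationary_def
  using assms is_stationary_unique by (intro the_equality) blast+

lemma is_stationary_stationary:
  assumes "strongly_connected E" "P \<in> kernels E"
  shows "is_stationary P (stationary P)"
  using ex_is_stationary[OF assms(2)] stationary_eqI[OF assms] by auto

lemma stationary_pos:
  assumes "strongly_connected E" "P \<in> kernels E"
  shows "0 < stationary P $ x"
  using assms is_stationary_stationary is_stationary_pos by blast

lemma stationary_invariant: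
  assumes "strongly_connected E" "P \<in> kernels E"
  shows "(\<Sum>x\<in>UNIV. stationary P $ x * P $ x $ y) = stationary P $ y"
  using is_stationary_stationary[OF assms] by (metis is_stationary_def vector_matrix_mult_nth)

subsection \<open>Time reversal\<close>

text \<open>Row \<open>x\<close> of the reversal is the flow into \<open>x\<close> divided by the
  stationary mass of \<open>x\<close>; invariance makes the two equal.\<close>

lemma reversal_in_kernels:
  assumes E: "strongly_connected E" and P: "P \<in> kernels E"
  shows "reversal P \<in> kernels (E\<inverse>)"
proof -
  note pos = stationary_pos[OF E P]
  have "(\<Sum>y\<in>UNIV. reversal P $ x $ y) = 1" for x
    using pos[of x]
    by (simp add: reversal_def sum_divide_distrib[symmetric] stationary_invariant[OF E P])
  moreover have "0 < reversal P $ x $ y" if "(x, y) \<in> E\<inverse>" for x y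
    using that pos kernels_pos[OF P] by (simp add: reversal_def)
  moreover have "reversal P $ x $ y = 0" if "(x, y) \<notin> E\<inverse>" for x y
    using that kernels_zero[OF P] by (simp add: reversal_def)
  ultimately show ?thesis by (simp add: kernels_def)
qed

text \<open>The mass of the starting point cancels the denominator of the reversal, leaving a row
  sum of \<open>P\<close>. So invariance for the reversal comes from stochasticity of
  \<open>P\<close>, dually to the row sums above.\<close>

lemma stationary_reversal:
  assumes E: "strongly_connected E" and P: "P \<in> kernels E"
  shows "stationary (reversal P) = stationary P"
proof (rule stationary_eqI)
  show "strongly_connected (E\<inverse>)" using E by (rule strongly_connected_converse)
  show "reversal P \<in> kernels (E\<inverse>)" using assms by (rule reversal_in_kernels)
  note pos = stationary_pos[OF E P]
  have nz: "stationary P $ x \<noteq> 0" for x using pos[of x] by simp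
  have "stationary P v* reversal P = stationary P"
    by (simp add: vec_eq_iff vector_matrix_mult_nth reversal_def nz
        sum_distrib_left[symmetric] kernels_sum[OF P])
  with is_stationary_stationary[OF E P] show "is_stationary (reversal P) (stationary P)"
    by (simp add: is_stationary_def)
qed

lemma edge_measure_reversal:
  assumes E: "strongly_connected E" and P: "P \<in> kernels E"
  shows "edge_measure (reversal P) = transpose (edge_measure P)"
proof -
  have nz: "stationary P $ x \<noteq> 0" for x using stationary_pos[OF E P, of x] by simp
  show ?thesis
    by (simp add: edge_measure_def vec_eq_iff transpose_def stationary_reversal[OF E P])
      (simp add: reversal_def nz)
qed

text \<open>Both reversals use the same stationary distribution, so their weights are mutually
  inverse.\<close>

lemma reversal_reversal:
  assumes E: "strongly_connected E" and P: "P \<in> kernels E"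
  shows "reversal (reversal P) = P"
proof -
  have nz: "stationary P $ x \<noteq> 0" for x using stationary_pos[OF E P, of x] by simp
  have "stationary (reversal P) $ y * reversal P $ y $ x / stationary (reversal P) $ x = P $ x $ y"
    for x y
    unfolding stationary_reversal[OF E P] by (simp add: reversal_def nz)
  then show ?thesis by (subst reversal_def) (simp add: vec_eq_iff)
qed

subsection \<open>m-families\<close>

lemma m_comb_transpose: "m_comb d (\<lambda>i. transpose (Q i)) \<xi> = transpose (m_comb d Q \<xi>)"
  by (simp add: m_comb_def vec_eq_iff transpose_def sum_component)

lemma m_params_transpose: "m_params (E\<inverse>) d (\<lambda>i. transpose (Q i)) = m_params E d Q"
  by (auto simp: m_params_def m_comb_transpose transpose_nth)

text \<open>Affine hulls commute with linear maps, and injectivity pulls back the membership of a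
  point in the hull of the others.\<close>

lemma affine_independent_injective_linear_image:
  fixes f :: "'a::euclidean_space \<Rightarrow> 'b::real_normed_vector"
  assumes f: "linear f" "inj f" and S: "\<not> affine_dependent S"
  shows "\<not> affine_dependent (f ` S)"
proof
  assume "affine_dependent (f ` S)"
  then obtain x where x: "x \<in> S" "f x \<in> affine hull (f ` S - {f x})"
    by (auto simp: affine_dependent_def)
  have "f ` S - {f x} = f ` (S - {x})" using f(2) by (auto simp: inj_eq)
  then have "f x \<in> f ` (affine hull (S - {x}))"
    using x(2) f(1) by (simp add: affine_hull_linear_image linear_conv_bounded_linear)
  then have "x \<in> affine hull (S - {x})" using f(2) by (simp add: inj_image_mem_iff)
  with x(1) S show False by (auto simp: affine_dependent_def)
qed

lemma m_generators_transpose: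
  assumes E: "strongly_connected E" and Q: "m_generators E d Q"
  shows "m_generators (E\<inverse>) d (\<lambda>i. transpose (Q i))"
proof -
  have lin: "linear (transpose :: real ^ 'a ^ 'a \<Rightarrow> _)"
    by (rule linearI) (simp_all add: transpose_def vec_eq_iff)
  have inj: "inj (transpose :: real ^ 'a ^ 'a \<Rightarrow> _)"
    by (metis injI transpose_transpose)
  \<comment> \<open>The kernel behind \<open>Q i\<close> is reversed, which transposes its edge
    measure.\<close>
  have "transpose (Q i) \<in> edge_measures (E\<inverse>)" if "i \<le> d" for i
  proof -
    obtain P where "P \<in> kernels E" "Q i = edge_measure P"
      using Q \<open>i \<le> d\<close> by (auto simp: m_generators_def edge_measures_def)
    then show ?thesis
      using E by (metis edge_measure_reversal edge_measures_def image_eqI reversal_in_kernels)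
  qed
  moreover have "inj_on (\<lambda>i. transpose (Q i)) {..d}"
    using Q by (auto simp: m_generators_def inj_on_def)
  moreover have "\<not> affine_dependent (transpose ` Q ` {..d})"
    using Q affine_independent_injective_linear_image[OF lin inj] by (simp add: m_generators_def)
  ultimately show ?thesis
    by (auto simp: m_generators_def image_image)
qed

lemma reversal_m_family_subset:
  assumes E: "strongly_connected E"
  shows "reversal ` m_family E d Q \<subseteq> m_family (E\<inverse>) d (\<lambda>i. transpose (Q i))"
  using reversal_in_kernels[OF E] edge_measure_reversal[OF E]
  by (fastforce simp: m_family_def m_params_transpose m_comb_transpose)

lemma reversal_m_family:
  assumes E: "strongly_connected E"
  shows "reversal ` m_family E d Q = m_family (E\<inverse>) d (\<lambda>i. transpose (Q i))"
proof (intro equalityI reversal_m_family_subset[OF E] subsetI)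
  note E' = strongly_connected_converse[OF E]
  fix P assume P: "P \<in> m_family (E\<inverse>) d (\<lambda>i. transpose (Q i))"
  \<comment> \<open>The forward inclusion is reused on the reversed graph with transposed
    generators; converse and transposition undo themselves.\<close>
  then have "reversal P \<in> m_family E d Q"
    using reversal_m_family_subset[OF E', of d "\<lambda>i. transpose (Q i)"] by auto
  moreover have "reversal (reversal P) = P"
    using P by (auto simp: m_family_def intro: reversal_reversal[OF E'])
  ultimately show "P \<in> reversal ` m_family E d Q" by (metis image_eqI)
qed

subsection \<open>e-families\<close>

text \<open>Exchanging the arguments sends \<open>f y - f x + c\<close> to the same form with
  \<open>- f\<close>, so the functions factored out are preserved.\<close>

lemma e_generators_transpose:
  assumes "e_generators E d g"
  shows "e_generators (E\<inverse>) d (\<lambda>i. transpose (g i))"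
  unfolding e_generators_def
proof (intro allI impI)
  fix a :: "nat \<Rightarrow> real" and f c i
  assume "\<forall>(x, y)\<in>E\<inverse>. (\<Sum>i<d. a i * transpose (g i) $ x $ y) = f y - f x + c" and i: "i < d"
  then have "\<forall>(x, y)\<in>E. (\<Sum>i<d. a i * g i $ x $ y) = (- f y) - (- f x) + c"
    by (auto simp: transpose_def)
  with assms i show "a i = 0"
    unfolding e_generators_def by (elim allE[where x = a] allE[where x = "\<lambda>x. - f x"]) blast
qed

lemma ln_reversal:
  assumes E: "strongly_connected E" and P: "P \<in> kernels E" and "(x, y) \<in> E\<inverse>"
  shows "ln (reversal P $ x $ y) =
    ln (P $ y $ x) + ln (stationary P $ y) - ln (stationary P $ x)"
  using stationary_pos[OF E P, of x] stationary_pos[OF E P, of y] kernels_pos[OF P, of y x] assms(3)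
  by (simp add: reversal_def ln_div ln_mult)

lemma e_family_reversal:
  assumes E: "strongly_connected E" and e: "e_family E d K g \<Theta> \<psi> P"
  shows "e_family (E\<inverse>) d (transpose K) (\<lambda>i. transpose (g i)) \<Theta> \<psi> (\<lambda>\<theta>. reversal (P \<theta>))"
proof -
  have P: "P \<theta> \<in> kernels E" if "\<theta> \<in> \<Theta>" for \<theta>
    using e that by (auto simp: e_family_def)
  obtain R where R: "\<And>\<theta> x y. \<theta> \<in> \<Theta> \<Longrightarrow> (x, y) \<in> E \<Longrightarrow>
      ln (P \<theta> $ x $ y) = e_exponent d K g \<theta> x y + R \<theta> y - R \<theta> x - \<psi> \<theta>"
    using e unfolding e_family_def by blast
  define R' where "R' = (\<lambda>\<theta> x. ln (stationary (P \<theta>) $ x) - R \<theta> x)"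
  have "ln (reversal (P \<theta>) $ x $ y) =
      e_exponent d (transpose K) (\<lambda>i. transpose (g i)) \<theta> x y + R' \<theta> y - R' \<theta> x - \<psi> \<theta>"
    if "\<theta> \<in> \<Theta>" "(x, y) \<in> E\<inverse>" for \<theta> x y
    using that by (simp add: ln_reversal[OF E P] R R'_def e_exponent_def transpose_def)
  moreover have "reversal (P \<theta>) \<in> kernels (E\<inverse>)" if "\<theta> \<in> \<Theta>" for \<theta>
    using reversal_in_kernels[OF E P[OF that]] .
  moreover have "reversal (P \<theta>) $ x $ y = 0" if "\<theta> \<in> \<Theta>" "(x, y) \<notin> E\<inverse>" for \<theta> x y
    using kernels_zero[OF reversal_in_kernels[OF E P]] that by blast
  moreover have "e_params d \<Theta>" "e_generators (E\<inverse>) d (\<lambda>i. transpose (g i))"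
    using e e_generators_transpose by (auto simp: e_family_def)
  ultimately show ?thesis
    unfolding e_family_def image_subset_iff by (intro conjI exI[where x = R'] ballI allI impI)
qed

subsection \<open>Perron--Frobenius eigenvectors\<close>

text \<open>Pairing \<open>\<bar>l\<bar> \<bar>w\<bar> \<le> A \<bar>w\<bar>\<close> with a positive left eigenvector bounds every eigenvalue \<open>l\<close>.\<close>

lemma spec_radius_eqI:
  assumes A: "\<And>x y. 0 \<le> A $ x $ y"
    and v: "\<And>x. 0 < v $ x" "v v* A = r *s v"
    and u: "u \<noteq> 0" "A *v u = r *s u"
    and r: "0 \<le> r"
  shows "spec_radius A = r"
  unfolding spec_radius_def
\<comment> \<open>The supremum is attained: \<open>u\<close>, embedded in the complex vectors, has
  eigenvalue \<open>r\<close>, whose modulus is \<open>r\<close> because \<open>r\<close> is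
  non-negative.\<close>
proof (rule cSup_eq_maximum)
  let ?u = "\<chi> x. complex_of_real (u $ x)"
  have "map_matrix complex_of_real A *v ?u = complex_of_real r *s ?u"
  proof -
    have "(\<Sum>y\<in>UNIV. A $ x $ y * u $ y) = r * u $ x" for x
      using u(2) by (simp add: vec_eq_iff matrix_vector_mult_def)
    then show ?thesis
      by (simp add: vec_eq_iff matrix_vector_mult_def map_matrix_def
          flip: of_real_mult of_real_sum)
  qed
  moreover have "?u \<noteq> 0" using u(1) by (simp add: vec_eq_iff)
  moreover have "r = cmod (complex_of_real r)" using r by simp
  ultimately show "r \<in> {cmod l |l. \<exists>w. w \<noteq> 0 \<and> map_matrix complex_of_real A *v w = l *s w}"
    by blast
next
  fix b assume "b \<in> {cmod l |l. \<exists>w. w \<noteq> 0 \<and> map_matrix complex_of_real A *v w = l *s w}"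
  then obtain l w where b: "b = cmod l" and "w \<noteq> 0"
    and w: "map_matrix complex_of_real A *v w = l *s w" by blast
  let ?s = "\<Sum>x\<in>UNIV. v $ x * cmod (w $ x)"
  have "cmod l * cmod (w $ x) \<le> (\<Sum>y\<in>UNIV. A $ x $ y * cmod (w $ y))" for x
  proof -
    have "l * w $ x = (\<Sum>y\<in>UNIV. complex_of_real (A $ x $ y) * w $ y)"
      using w by (simp add: vec_eq_iff matrix_vector_mult_def map_matrix_def)
    then have "cmod l * cmod (w $ x) = cmod (\<Sum>y\<in>UNIV. complex_of_real (A $ x $ y) * w $ y)"
      by (metis norm_mult)
    also have "\<dots> \<le> (\<Sum>y\<in>UNIV. cmod (complex_of_real (A $ x $ y) * w $ y))"
      by (rule norm_sum)
    finally show ?thesis by (simp add: norm_mult A)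
  qed
  then have "v $ x * (cmod l * cmod (w $ x)) \<le> v $ x * (\<Sum>y\<in>UNIV. A $ x $ y * cmod (w $ y))" for x
    using v(1) by (simp add: less_imp_le mult_left_mono)
  then have "(\<Sum>x\<in>UNIV. v $ x * (cmod l * cmod (w $ x)))
      \<le> (\<Sum>x\<in>UNIV. v $ x * (\<Sum>y\<in>UNIV. A $ x $ y * cmod (w $ y)))"
    by (intro sum_mono)
  also have "\<dots> = (\<Sum>y\<in>UNIV. \<Sum>x\<in>UNIV. v $ x * A $ x $ y * cmod (w $ y))"
    by (subst sum.swap) (simp add: sum_distrib_left mult.assoc)
  also have "\<dots> = (\<Sum>y\<in>UNIV. (v v* A) $ y * cmod (w $ y))"
    by (simp add: vector_matrix_mult_nth sum_distrib_right)
  also have "\<dots> = r * ?s"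
    by (simp add: v(2) sum_distrib_left mult.assoc)
  finally have "cmod l * ?s \<le> r * ?s"
    by (simp add: sum_distrib_left mult.left_commute)
  \<comment> \<open>Positivity of the pairing allows \<open>?s\<close> to be cancelled; a nonzero
    entry of \<open>w\<close> provides it.\<close>
  moreover have "0 < ?s"
  proof -
    obtain z where "w $ z \<noteq> 0" using \<open>w \<noteq> 0\<close> by (auto simp: vec_eq_iff)
    then have "0 < v $ z * cmod (w $ z)" using v(1) by simp
    then show ?thesis
      by (intro sum_pos2[of _ z]) (auto simp: v(1) less_imp_le)
  qed
  ultimately show "b \<le> r" by (simp add: b)
qed

section \<open>Positive multiples of a diagonally conjugated kernel\<close>

context
  fixes E :: "('x::finite \<times> 'x) set" and P A :: "real ^ 'x ^ 'x"
    and R :: "'x \<Rightarrow> real" and p :: real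
  assumes E: "strongly_connected E" and P: "P \<in> kernels E"
    and A: "\<And>x y. A $ x $ y = exp p * (exp (R x) * P $ x $ y * exp (- R y))"
begin

lemma conjugate_kernel_nonneg: "0 \<le> A $ x $ y"
  by (simp add: A kernels_nonneg[OF P])

text \<open>The constant vector is fixed by \<open>P\<close>, and the conjugation carries it to
  \<open>exp R\<close>.\<close>

lemma conjugate_kernel_right: "A *v (\<chi> x. exp (R x)) = exp p *s (\<chi> x. exp (R x))"
proof -
  have "(\<Sum>y\<in>UNIV. A $ x $ y * exp (R y)) = (\<Sum>y\<in>UNIV. exp p * exp (R x) * P $ x $ y)" for x
    by (intro sum.cong) (simp_all add: A exp_minus)
  then show ?thesis
    by (simp add: vec_eq_iff matrix_vector_mult_def sum_distrib_left[symmetric] kernels_sum[OF P])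
qed

text \<open>Entrywise multiplication by \<open>exp R\<close> undoes the conjugation, so questions
  about left eigenvectors of \<open>A\<close> become questions about invariant vectors of
  \<open>P\<close>.\<close>

lemma conjugate_kernel_left_iff:
  "v v* A = exp p *s v \<longleftrightarrow> (\<chi> x. v $ x * exp (R x)) v* P = (\<chi> x. v $ x * exp (R x))"
proof -
  have "(v v* A) $ y = exp p * exp (- R y) * ((\<chi> x. v $ x * exp (R x)) v* P) $ y" for y
    by (simp add: vector_matrix_mult_nth A sum_distrib_left mult_ac)
  moreover have "exp p * exp (- R y) * a = exp p * b \<longleftrightarrow> a = b * exp (R y)" for a b y
    by (simp add: exp_minus field_simps)
  ultimately show ?thesis by (simp add: vec_eq_iff)
qed

lemma conjugate_kernel_left:
  "(\<chi> x. stationary P $ x * exp (- R x)) v* A =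
    exp p *s (\<chi> x. stationary P $ x * exp (- R x))"
  unfolding conjugate_kernel_left_iff
  by (simp add: mult.assoc flip: exp_add)
    (simp add: vec_eq_iff vector_matrix_mult_nth stationary_invariant[OF E P])

lemma conjugate_kernel_spec_radius: "spec_radius A = exp p"
  by (rule spec_radius_eqI[OF conjugate_kernel_nonneg _ conjugate_kernel_left _ conjugate_kernel_right])
    (simp_all add: stationary_pos[OF E P] vec_eq_iff)

text \<open>Transposition exchanges the two positive eigenvectors, so the same bound applies with
  their roles swapped.\<close>

lemma conjugate_kernel_spec_radius_transpose: "spec_radius (transpose A) = exp p"
proof (rule spec_radius_eqI)
  show "0 \<le> transpose A $ x $ y" for x y
    by (simp add: transpose_def conjugate_kernel_nonneg)
  show "(\<chi> x. exp (R x)) v* transpose A = exp p *s (\<chi> x. exp (R x))"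
    by (simp add: conjugate_kernel_right)
  show "transpose A *v (\<chi> x. stationary P $ x * exp (- R x)) =
      exp p *s (\<chi> x. stationary P $ x * exp (- R x))"
    by (simp add: conjugate_kernel_left)
  show "(\<chi> x. stationary P $ x * exp (- R x)) \<noteq> 0"
    using stationary_pos[OF E P] by (simp add: vec_eq_iff less_imp_neq[symmetric])
qed simp_all

text \<open>The eigenvector equations agree under transposition; only the spectral radii have to be
  compared, and both are \<open>exp p\<close>.\<close>

lemma conjugate_kernel_PF_transpose:
  "left_PF_eigenvector A v \<longleftrightarrow> right_PF_eigenvector (transpose A) v"
  by (simp add: left_PF_eigenvector_def right_PF_eigenvector_def
      conjugate_kernel_spec_radius conjugate_kernel_spec_radius_transpose)

lemma conjugate_kernel_PF_ex: "left_PF_eigenvector A (exp_vec (\<chi> x. ln (stationary P $ x) - R x))"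
proof -
  have "exp_vec (\<chi> x. ln (stationary P $ x) - R x) = (\<chi> x. stationary P $ x * exp (- R x))"
    by (simp add: exp_vec_def vec_eq_iff exp_diff exp_minus stationary_pos[OF E P] divide_inverse)
  then show ?thesis
    by (simp add: left_PF_eigenvector_def conjugate_kernel_spec_radius conjugate_kernel_left
        stationary_pos[OF E P])
qed

text \<open>By uniqueness of invariant vectors, \<open>exp (L + R)\<close> is a positive multiple
  \<open>c\<close> of the stationary distribution. Thus \<open>L\<close> is determined up to the
  constant \<open>ln c\<close>, which cancels in differences.\<close>

lemma conjugate_kernel_PF_diff:
  assumes "left_PF_eigenvector A (exp_vec L)"
  shows "L $ y - L $ x = (ln (stationary P $ y) - R y) - (ln (stationary P $ x) - R x)"
proof -
  have "exp_vec L v* A = exp p *s exp_vec L"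
    using assms by (simp add: left_PF_eigenvector_def conjugate_kernel_spec_radius)
  then have "(\<chi> x. exp (L $ x + R x)) v* P = (\<chi> x. exp (L $ x + R x))"
    unfolding conjugate_kernel_left_iff by (simp add: exp_vec_def exp_add)
  then obtain c where "(\<chi> x. exp (L $ x + R x)) = c *\<^sub>R stationary P"
    using invariant_unique[OF E P stationary_pos[OF E P]] is_stationary_stationary[OF E P]
    unfolding is_stationary_def by blast
  then have c: "exp (L $ z + R z) = c * stationary P $ z" for z
    by (simp add: vec_eq_iff)
  then have "0 < c * stationary P $ x" by (metis exp_gt_zero)
  then have "0 < c" using stationary_pos[OF E P, of x] by (rule zero_less_mult_pos2)
  have "L $ z + R z = ln (c * stationary P $ z)" for z
    by (simp flip: c)
  then have "L $ z + R z = ln c + ln (stationary P $ z)" for z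
    using \<open>0 < c\<close> stationary_pos[OF E P, of z] by (simp add: ln_mult_pos)
  then have "L $ z = ln c + (ln (stationary P $ z) - R z)" for z
    by (simp add: algebra_simps)
  then show ?thesis by simp
qed

end

lemma e_tilde_conjugate_kernel:
  assumes P: "P \<in> kernels E"
    and ln: "\<And>x y. (x, y) \<in> E \<Longrightarrow> ln (P $ x $ y) = e_exponent d K g \<theta> x y + R y - R x - p"
  shows "e_tilde E d K g \<theta> $ x $ y = exp p * (exp (R x) * P $ x $ y * exp (- R y))"
proof (cases "(x, y) \<in> E")
  case True
  have "exp (e_exponent d K g \<theta> x y) = exp (p + R x + ln (P $ x $ y) + - R y)"
    using ln[OF True] by simp
  also have "\<dots> = exp p * (exp (R x) * P $ x $ y * exp (- R y))"
    unfolding exp_add using kernels_pos[OF P True] by simp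
  finally show ?thesis using True by (simp add: e_tilde_def)
next
  case False
  then show ?thesis by (simp add: e_tilde_def kernels_zero[OF P])
qed

text \<open>Since \<open>L\<close> is fixed only up to an additive constant, the formula is claimed
  for every \<open>L\<close> whose exponential is an eigenvector; the separate existence claim keeps
  this from being vacuous.\<close>

theorem proposition3p1:
  fixes E :: "('x::finite \<times> 'x) set"
  assumes "CARD('x) \<ge> 2"
    and "strongly_connected E"
  shows
    "(\<forall>V. is_m_family E V \<longrightarrow> is_m_family (E\<inverse>) (reversal ` V)) \<and>
     (\<forall>d Q. m_generators E d Q \<longrightarrow>
        reversal ` m_family E d Q =
          {P \<in> kernels (E\<inverse>). \<exists>\<xi> \<in> m_params (E\<inverse>) d (\<lambda>i. transpose (Q i)).
             edge_measure P = m_comb d (\<lambda>i. transpose (Q i)) \<xi>} \<and>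
        m_params (E\<inverse>) d (\<lambda>i. transpose (Q i)) = m_params E d Q) \<and>
     (\<forall>V. is_e_family E V \<longrightarrow> is_e_family (E\<inverse>) (reversal ` V)) \<and>
     (\<forall>V d K g \<Theta> \<psi> P. e_family E d K g \<Theta> \<psi> P \<and> V = P ` \<Theta> \<longrightarrow>
        reversal ` V = {reversal (P \<theta>) |\<theta>. \<theta> \<in> \<Theta>} \<and>
        (\<forall>\<theta>\<in>\<Theta>.
           (\<exists>L. left_PF_eigenvector (e_tilde E d K g \<theta>) (exp_vec L)) \<and>
           (\<forall>L. left_PF_eigenvector (e_tilde E d K g \<theta>) (exp_vec L) \<longleftrightarrow>
                right_PF_eigenvector (transpose (e_tilde E d K g \<theta>)) (exp_vec L)) \<and>
           (\<forall>L. left_PF_eigenvector (e_tilde E d K g \<theta>) (exp_vec L) \<longrightarrow>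
              (\<forall>x x'.
                 ((x, x') \<in> E\<inverse> \<longrightarrow>
                    ln (reversal (P \<theta>) $ x $ x') =
                      K $ x' $ x + (\<Sum>i<d. \<theta> i * g i $ x' $ x) + L $ x' - L $ x - \<psi> \<theta>) \<and>
                 ((x, x') \<notin> E\<inverse> \<longrightarrow> reversal (P \<theta>) $ x $ x' = 0)))))"
proof (intro conjI allI impI, goal_cases)
  note E = assms(2)
  case (1 V)
  then show ?case
    unfolding is_m_family_def using m_generators_transpose[OF E] reversal_m_family[OF E] by blast
next
  case (2 d Q)
  show ?case
    using reversal_m_family[OF assms(2)] by (simp add: m_family_def)
next
  case (3 d Q)
  show ?case by (rule m_params_transpose)
next
  case (4 V)
  then obtain d K g \<Theta> \<psi> P where "e_family E d K g \<Theta> \<psi> P" and V: "V = P ` \<Theta>"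
    unfolding is_e_family_def by blast
  from e_family_reversal[OF assms(2) this(1)] show ?case
    unfolding is_e_family_def V image_image by blast
next
  case (5 V d K g \<Theta> \<psi> P)
  then show ?case by auto
next
  case (6 V d K g \<Theta> \<psi> P)
  note E = assms(2)
  show ?case
  proof
    fix \<theta> assume \<theta>: "\<theta> \<in> \<Theta>"
    have P: "P \<theta> \<in> kernels E" using 6 \<theta> by (auto simp: e_family_def)
    obtain R where R: "\<And>x y. (x, y) \<in> E \<Longrightarrow>
        ln (P \<theta> $ x $ y) = e_exponent d K g \<theta> x y + R y - R x - \<psi> \<theta>"
      using 6 \<theta> unfolding e_family_def by blast
    \<comment> \<open>The conjugation results now apply with \<open>p\<close> equal to
      \<open>\<psi> \<theta>\<close>, so the potential is the logarithm of the spectral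
      radius.\<close>
    note A = e_tilde_conjugate_kernel[OF P R]
    \<comment> \<open>The stationary weights add the difference of \<open>ln \<pi>\<close> to that
      of \<open>- R\<close>, which together give exactly \<open>L $ y - L $ x\<close>.\<close>
    have ln: "ln (reversal (P \<theta>) $ x $ y) =
        K $ y $ x + (\<Sum>i<d. \<theta> i * g i $ y $ x) + L $ y - L $ x - \<psi> \<theta>"
      if "left_PF_eigenvector (e_tilde E d K g \<theta>) (exp_vec L)" "(x, y) \<in> E\<inverse>" for L x y
      using conjugate_kernel_PF_diff[OF E P A that(1), of y x] ln_reversal[OF E P that(2)]
        R[of y x] that(2) by (simp add: e_exponent_def)
    show "(\<exists>L. left_PF_eigenvector (e_tilde E d K g \<theta>) (exp_vec L)) \<and>
      (\<forall>L. left_PF_eigenvector (e_tilde E d K g \<theta>) (exp_vec L) \<longleftrightarrow>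
          right_PF_eigenvector (transpose (e_tilde E d K g \<theta>)) (exp_vec L)) \<and>
      (\<forall>L. left_PF_eigenvector (e_tilde E d K g \<theta>) (exp_vec L) \<longrightarrow>
        (\<forall>x x'.
          ((x, x') \<in> E\<inverse> \<longrightarrow>
            ln (reversal (P \<theta>) $ x $ x') =
              K $ x' $ x + (\<Sum>i<d. \<theta> i * g i $ x' $ x) + L $ x' - L $ x - \<psi> \<theta>) \<and>
          ((x, x') \<notin> E\<inverse> \<longrightarrow> reversal (P \<theta>) $ x $ x' = 0)))"
      using conjugate_kernel_PF_ex[OF E P A] conjugate_kernel_PF_transpose[OF E P A] ln
        kernels_zero[OF reversal_in_kernels[OF E P]] by blast
  qed
qed

end
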